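(* Let $d\ge 2$ and $m_1,\ldots,m_d\ge 2$ be integers and let $f:\mathbb{R}^{m_1}\times\cdots\times\mathbb{R}^{m_d}\to\mathbb{R}$, $$f(\mathbf{x}_1,\ldots,\mathbf{x}_d)=\sum_{i_1\in[m_1],\ldots,i_d\in[m_d]} f_{i_1,\ldots,i_d}\,x_{i_1,1}\cdots x_{i_d,d},$$ be a nonnegative multilinear form, i.e. one whose coefficient tensor $\mathcal{F}=[f_{i_1,\ldots,i_d}]$ is nonnegative. Let $p_1,\ldots,p_d\in(1,\infty)$. Consider the system, in the unknowns $\mathbf{x}_1,\ldots,\mathbf{x}_d$ (and a scalar $\lambda$), $$\sum_{i_l\in[m_l],\ l\in[d]\setminus\{j\}} f_{i_1,\ldots,i_d}\prod_{l\in[d]\setminus\{j\}}x_{i_l,l}=\lambda\, x_{i_j,j}^{p_j-1}\quad\text{for all } j\in[d],\ i_j\in[m_j],\qquad (\mathrm{S})$$ with $\mathbf{x}_j\in\mathbb{R}^{m_j}$, $\mathbf{x}_j\ge \mathbf{0}$, $\|\mathbf{x}_j\|_{p_j}=1$ for all $j\in[d]$. Assume that $\mathcal{F}$ is weakly irreducible and $p_j\ge d$ for all $j\in[d]$. Then the system (S) has a unique positive solution $(\mathbf{x}_1,\ldots,\mathbf{x}_d)>\mathbf{0}$. If $\mathcal{F}$ is irreducible (and $p_j\ge d$ for all $j\in[d]$), then the system (S) has a unique solution $(\mathbf{x}_1,\ldots,\mathbf{x}_d)$, which is necessarily positive.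
   Context: $[m]=\{1,\ldots,m\}$. Write $\mathbf{x}_j=(x_{1,j},\ldots,x_{m_j,j})^\top\in\mathbb{R}^{m_j}$. $\|\mathbf{u}\|_p=(\sum_i|u_i|^p)^{1/p}$. A tensor is nonnegative if all its entries are nonnegative; $>\mathbf{0}$ (positive) means that all coordinates are positive. A tuple $(\mathbf{x}_1,\ldots,\mathbf{x}_d)$ is a solution if (S) and the constraints hold for some scalar $\lambda$. Let $V$ be the disjoint union $V=V_1\sqcup\cdots\sqcup V_d$ with $V_j=[m_j]$. Let $G(\mathcal{F})$ be the undirected $d$-partite graph with vertex set $V$ in which, for $k\ne l$, $i_k\in V_k$ and $i_l\in V_l$ are joined by an edge if and only if $f_{i_1,\ldots,i_d}>0$ for some choice of the remaining $d-2$ indices $i_j\in V_j$, $j\notin\{k,l\}$. There are no other edges. The tensor $\mathcal{F}$ is weakly irreducible if $G(\mathcal{F})$ is connected. The tensor $\mathcal{F}$ is irreducible if for each proper nonempty subset $\emptyset\ne I\subsetneqq V$ the following holds with $J:=V\setminus I$: there exist $k\in[d]$, $i_k\in I\cap V_k$, and $i_j\in J\cap V_j$ for each $j\in[d]\setminus\{k\}$, such that $f_{i_1,\ldots,i_d}>0$. *)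

theory Defs
  imports "HOL-Analysis.Analysis" "Graph_Theory.Graph_Theory"
begin

text \<open>
  Throughout, \<open>d\<close> is the order of the tensor and \<open>m j\<close> is the dimension of its \<open>j\<close>-th mode,
  both 1-based. A tensor is a function of multi-indices \<open>e\<close> with \<open>e j = i\<^sub>j\<close>; only its values on
  \<^term>\<open>multi_indices d m\<close> are ever used. A tuple of vectors is a function \<open>x\<close> with
  \<open>x j i = x\<^bsub>i,j\<^esub>\<close>, made extensional so that equality of tuples is equality of their coordinates.
\<close>

definition multi_indices :: "nat \<Rightarrow> (nat \<Rightarrow> nat) \<Rightarrow> (nat \<Rightarrow> nat) set" where
  "multi_indices d m = (\<Pi>\<^sub>E j\<in>{1..d}. {1..m j})"

definition vector_tuples :: "nat \<Rightarrow> (nat \<Rightarrow> nat) \<Rightarrow> (nat \<Rightarrow> nat \<Rightarrow> real) set" where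
  "vector_tuples d m = (\<Pi>\<^sub>E j\<in>{1..d}. \<Pi>\<^sub>E i\<in>{1..m j}. UNIV)"

definition nonneg_tensor :: "nat \<Rightarrow> (nat \<Rightarrow> nat) \<Rightarrow> ((nat \<Rightarrow> nat) \<Rightarrow> real) \<Rightarrow> bool" where
  "nonneg_tensor d m F \<longleftrightarrow> (\<forall>e\<in>multi_indices d m. F e \<ge> 0)"

definition nonneg_tuple :: "nat \<Rightarrow> (nat \<Rightarrow> nat) \<Rightarrow> (nat \<Rightarrow> nat \<Rightarrow> real) \<Rightarrow> bool" where
  "nonneg_tuple d m x \<longleftrightarrow> (\<forall>j\<in>{1..d}. \<forall>i\<in>{1..m j}. x j i \<ge> 0)"

definition positive_tuple :: "nat \<Rightarrow> (nat \<Rightarrow> nat) \<Rightarrow> (nat \<Rightarrow> nat \<Rightarrow> real) \<Rightarrow> bool" where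
  "positive_tuple d m x \<longleftrightarrow> (\<forall>j\<in>{1..d}. \<forall>i\<in>{1..m j}. x j i > 0)"

definition p_norm :: "real \<Rightarrow> nat \<Rightarrow> (nat \<Rightarrow> real) \<Rightarrow> real" where
  "p_norm p n u = (\<Sum>i\<in>{1..n}. \<bar>u i\<bar> powr p) powr (1 / p)"

text \<open>
  The left-hand side of equation \<open>(j, i)\<close> of the system (S), with \<open>i\<^sub>j = i\<close>: the multi-index
  \<open>e\<close> ranges over the remaining modes, and \<open>e(j := i)\<close> is the completed multi-index.
\<close>

definition partial_form ::
  "nat \<Rightarrow> (nat \<Rightarrow> nat) \<Rightarrow> ((nat \<Rightarrow> nat) \<Rightarrow> real) \<Rightarrow> (nat \<Rightarrow> nat \<Rightarrow> real) \<Rightarrow> nat \<Rightarrow> nat \<Rightarrow> real" where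
  "partial_form d m F x j i =
     (\<Sum>e\<in>(\<Pi>\<^sub>E l\<in>{1..d} - {j}. {1..m l}). F (e(j := i)) * (\<Prod>l\<in>{1..d} - {j}. x l (e l)))"

definition is_solution ::
  "nat \<Rightarrow> (nat \<Rightarrow> nat) \<Rightarrow> (nat \<Rightarrow> real) \<Rightarrow> ((nat \<Rightarrow> nat) \<Rightarrow> real) \<Rightarrow> (nat \<Rightarrow> nat \<Rightarrow> real) \<Rightarrow> bool" where
  "is_solution d m p F x \<longleftrightarrow>
     x \<in> vector_tuples d m \<and>
     (\<exists>mu::real. \<forall>j\<in>{1..d}. \<forall>i\<in>{1..m j}. partial_form d m F x j i = mu * x j i powr (p j - 1)) \<and>
     nonneg_tuple d m x \<and>
     (\<forall>j\<in>{1..d}. p_norm (p j) (m j) (x j) = 1)"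

text \<open>The pair \<open>(j, i)\<close> is the vertex \<open>i\<close> of \<open>V\<^sub>j\<close>.\<close>

definition tensor_vertices :: "nat \<Rightarrow> (nat \<Rightarrow> nat) \<Rightarrow> (nat \<times> nat) set" where
  "tensor_vertices d m = (SIGMA j:{1..d}. {1..m j})"

text \<open>The undirected graph \<open>G(F)\<close> is represented by its symmetric set of arcs.\<close>

definition tensor_graph ::
  "nat \<Rightarrow> (nat \<Rightarrow> nat) \<Rightarrow> ((nat \<Rightarrow> nat) \<Rightarrow> real) \<Rightarrow> (nat \<times> nat) pair_pre_digraph" where
  "tensor_graph d m F =
     \<lparr>pverts = tensor_vertices d m,
      parcs = {((k, a), (l, b)) | k a l b.
                 k \<in> {1..d} \<and> l \<in> {1..d} \<and> k \<noteq> l \<and>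
                 (\<exists>e\<in>multi_indices d m. e k = a \<and> e l = b \<and> F e > 0)}\<rparr>"

definition weakly_irreducible :: "nat \<Rightarrow> (nat \<Rightarrow> nat) \<Rightarrow> ((nat \<Rightarrow> nat) \<Rightarrow> real) \<Rightarrow> bool" where
  "weakly_irreducible d m F \<longleftrightarrow> Digraph_Component.connected (with_proj (tensor_graph d m F))"

definition irreducible_tensor :: "nat \<Rightarrow> (nat \<Rightarrow> nat) \<Rightarrow> ((nat \<Rightarrow> nat) \<Rightarrow> real) \<Rightarrow> bool" where
  "irreducible_tensor d m F \<longleftrightarrow>
     (\<forall>I. I \<noteq> {} \<and> I \<subset> tensor_vertices d m \<longrightarrow>
       (\<exists>k\<in>{1..d}. \<exists>e\<in>multi_indices d m.
          (k, e k) \<in> I \<and>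
          (\<forall>j\<in>{1..d} - {k}. (j, e j) \<in> tensor_vertices d m - I) \<and>
          F e > 0))"

end

theory Submission
  imports Defs
begin

text \<open>
  Substitute \<open>u\<^bsub>i,j\<^esub> = x\<^bsub>i,j\<^esub>\<^bsup>p\<^sub>j\<^esup>\<close>: every \<open>u\<^sub>j\<close> then lies in a simplex, and since
  \<open>\<Sum>\<^sub>j 1/p\<^sub>j \<le> 1\<close> the form becomes a nonnegative combination of concave monomials
  \<open>\<Prod>\<^sub>j u\<^bsub>i\<^sub>j,j\<^esub>\<^bsup>1/p\<^sub>j\<^esup>\<close>. A maximiser exists by compactness. If some but not all of the factors of
  a monomial with positive coefficient vanish at it, moving by \<open>t\<close> towards the barycentre gains
  order \<open>t\<^sup>s\<close> with \<open>s < 1\<close> from this monomial and loses only order \<open>t\<close> overall; hence by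
  connectedness the maximiser is positive, and the first-order conditions are the system (S).
  Uniqueness of the positive solution is the equality case of the weighted AM-GM inequality
  applied to each monomial, again propagated by connectedness.
\<close>

declare One_nat_def [simp del]

subsection \<open>Weighted AM-GM and compactness of products\<close>

text \<open>The deficit \<open>1 - sum w J\<close> acts as the weight of an extra value 1, so
  \<open>A\<close> is a true weighted mean. Summing \<open>ln t <= t - 1\<close> with these weights
  at \<open>t = r j / A\<close> and \<open>t = 1 / A\<close> makes the right-hand sides cancel;
  equality then forces \<open>r j / A = 1\<close> for each \<open>j\<close>, as every
  \<open>w j\<close> is positive.\<close>

lemma weighted_am_gm:
  fixes w r :: "'a \<Rightarrow> real"
  assumes "finite J" and w: "\<And>j. j \<in> J \<Longrightarrow> w j > 0" and r: "\<And>j. j \<in> J \<Longrightarrow> r j > 0"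
    and W: "sum w J \<le> 1" and A: "A = (\<Sum>j\<in>J. w j * r j) + (1 - sum w J)"
  shows "(\<Prod>j\<in>J. r j powr w j) \<le> A"
    and "(\<Prod>j\<in>J. r j powr w j) = A \<Longrightarrow> j \<in> J \<Longrightarrow> r j = A"
proof -
  have rn: "r j \<noteq> 0" if "j \<in> J" for j using r[OF that] by simp
  have A0: "A > 0"
  proof (cases "J = {}")
    case False
    have "0 < (\<Sum>j\<in>J. w j * r j)"
      using False assms(1) w r by (intro sum_pos) auto
    then show ?thesis using W A by simp
  qed (use A in simp)
  have le: "w j * ln (r j / A) \<le> w j * (r j / A - 1)" if "j \<in> J" for j
    using that w[OF that] r[OF that] A0 by (intro mult_left_mono ln_le_minus_one) auto
  have "(1 - sum w J) * ln (1 / A) \<le> (1 - sum w J) * (1 / A - 1)"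
    using W A0 by (intro mult_left_mono ln_le_minus_one) auto
  moreover have "(\<Sum>j\<in>J. w j * (r j / A - 1)) + (1 - sum w J) * (1 / A - 1) = 0"
  proof -
    have "(\<Sum>j\<in>J. w j * (r j / A - 1)) = (\<Sum>j\<in>J. w j * r j) / A - sum w J"
      by (simp add: algebra_simps sum_subtractf sum_divide_distrib)
    moreover have "(\<Sum>j\<in>J. w j * r j) = A - (1 - sum w J)" using A by simp
    ultimately show ?thesis using A0 by (simp add: field_simps)
  qed
  moreover have "ln (\<Prod>j\<in>J. r j powr w j) - ln A
      = (\<Sum>j\<in>J. w j * ln (r j / A)) + (1 - sum w J) * ln (1 / A)"
  proof -
    have "ln (\<Prod>j\<in>J. r j powr w j) = (\<Sum>j\<in>J. w j * ln (r j))"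
      using assms(1) rn by (subst ln_prod) (auto intro!: sum.cong)
    moreover have "(\<Sum>j\<in>J. w j * ln (r j / A)) = (\<Sum>j\<in>J. w j * ln (r j) - w j * ln A)"
      using rn A0 by (intro sum.cong) (auto simp: ln_div right_diff_distrib)
    ultimately show ?thesis
      using A0 by (simp only: ln_div sum_subtractf sum_distrib_right[symmetric]) (simp add: ln_div algebra_simps)
  qed
  ultimately have diff: "ln (\<Prod>j\<in>J. r j powr w j) - ln A
      \<le> (\<Sum>j\<in>J. w j * ln (r j / A)) - (\<Sum>j\<in>J. w j * (r j / A - 1))"
    by linarith
  have P0: "(\<Prod>j\<in>J. r j powr w j) > 0"
    using rn by (intro prod_pos) auto
  have sum_le: "(\<Sum>j\<in>J. w j * ln (r j / A)) \<le> (\<Sum>j\<in>J. w j * (r j / A - 1))"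
    by (intro sum_mono le)
  show "(\<Prod>j\<in>J. r j powr w j) \<le> A"
    using diff sum_le by (intro ln_le_cancel_iff[OF P0 A0, THEN iffD1]) linarith
  assume eq: "(\<Prod>j\<in>J. r j powr w j) = A" and j: "j \<in> J"
  show "r j = A"
  proof (rule ccontr)
    assume "r j \<noteq> A"
    then have "ln (r j / A) \<noteq> r j / A - 1"
      using ln_eq_minus_one[of "r j / A"] r[OF j] A0 by auto
    then have "w j * ln (r j / A) < w j * (r j / A - 1)"
      using le[OF j] w[OF j] by (simp add: less_le)
    then have "(\<Sum>j\<in>J. w j * ln (r j / A)) < (\<Sum>j\<in>J. w j * (r j / A - 1))"
      using assms(1) j le by (intro sum_strict_mono_ex1) auto
    then show False using diff eq by simp
  qed
qed

text \<open>Coordinates outside \<open>I\<close> are pinned to \<open>undefined\<close>; giving them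
  that singleton as factor turns \<open>PiE I K\<close> into a full product of compact sets, to
  which Tychonoff applies.\<close>

lemma compact_PiE:
  fixes K :: "'i \<Rightarrow> 'a::topological_space set"
  assumes "\<And>i. i \<in> I \<Longrightarrow> compact (K i)"
  shows "compact (PiE I K)"
proof -
  define L where "L = (\<lambda>i. if i \<in> I then K i else {undefined})"
  have "compactin (product_topology (\<lambda>i. euclidean) UNIV) (PiE UNIV L)"
    using assms by (auto simp: compactin_PiE L_def)
  moreover have "PiE UNIV L = PiE I K"
    by (force simp: L_def PiE_def Pi_def extensional_def)
  ultimately show ?thesis
    by (simp add: euclidean_product_topology)
qed

lemma continuous_on_entry:
  "continuous_on S (\<lambda>x :: 'a \<Rightarrow> 'b \<Rightarrow> 'c::topological_space. x j i)"
  by (rule continuous_on_product_then_coordinatewise[OF continuous_on_product_then_coordinatewise[OF continuous_on_id]])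

subsection \<open>The multilinear form\<close>

definition multilinear_form ::
  "nat \<Rightarrow> (nat \<Rightarrow> nat) \<Rightarrow> ((nat \<Rightarrow> nat) \<Rightarrow> real) \<Rightarrow> (nat \<Rightarrow> nat \<Rightarrow> real) \<Rightarrow> real" where
  "multilinear_form d m F x = (\<Sum>e\<in>multi_indices d m. F e * (\<Prod>j\<in>{1..d}. x j (e j)))"

lemma finite_multi_indices [simp]: "finite (multi_indices d m)"
  unfolding multi_indices_def by (intro finite_PiE) auto

lemma multi_indices_nth: "e \<in> multi_indices d m \<Longrightarrow> j \<in> {1..d} \<Longrightarrow> e j \<in> {1..m j}"
  unfolding multi_indices_def by (rule PiE_mem)

lemma sum_multi_indices_split:
  assumes "j \<in> {1..d}"
  shows "(\<Sum>e\<in>multi_indices d m. g e)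
    = (\<Sum>i\<in>{1..m j}. \<Sum>e\<in>(\<Pi>\<^sub>E l\<in>{1..d} - {j}. {1..m l}). g (e(j := i)))"
proof -
  let ?E = "\<Pi>\<^sub>E l\<in>{1..d} - {j}. {1..m l}"
  have "multi_indices d m = (\<Pi>\<^sub>E l\<in>insert j ({1..d} - {j}). {1..m l})"
    using assms by (simp add: multi_indices_def insert_absorb)
  then have "multi_indices d m = (\<lambda>(i, e). e(j := i)) ` ({1..m j} \<times> ?E)"
    by (simp only: PiE_insert_eq)
  moreover have "inj_on (\<lambda>(i, e). e(j := i)) ({1..m j} \<times> ?E)"
    by (rule inj_combinator) simp
  ultimately show ?thesis
    by (simp add: sum.reindex sum.cartesian_product case_prod_unfold)
qed

text \<open>Groups the monomials by their index in mode \<open>j\<close>. The case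
  \<open>h = 1\<close> is Euler's identity for that mode; the general case serves the averages of
  ratios in the uniqueness proof.\<close>

lemma sum_entries_weighted:
  assumes "j \<in> {1..d}"
  shows "(\<Sum>e\<in>multi_indices d m. F e * (\<Prod>l\<in>{1..d}. x l (e l)) * h (e j))
    = (\<Sum>i\<in>{1..m j}. partial_form d m F x j i * x j i * h i)"
proof -
  have "F (e(j := i)) * (\<Prod>l\<in>{1..d}. x l ((e(j := i)) l)) * h ((e(j := i)) j)
      = F (e(j := i)) * (\<Prod>l\<in>{1..d} - {j}. x l (e l)) * (x j i * h i)" for e i
  proof -
    have "(\<Prod>l\<in>{1..d}. x l ((e(j := i)) l)) = x j i * (\<Prod>l\<in>{1..d} - {j}. x l ((e(j := i)) l))"
      using assms by (subst prod.remove[of _ j]) auto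
    also have "(\<Prod>l\<in>{1..d} - {j}. x l ((e(j := i)) l)) = (\<Prod>l\<in>{1..d} - {j}. x l (e l))"
      by (intro prod.cong) auto
    finally show ?thesis by simp
  qed
  then show ?thesis
    by (simp only: sum_multi_indices_split[OF assms] partial_form_def sum_distrib_right mult.assoc)
qed

lemma multilinear_form_expand:
  assumes "j \<in> {1..d}"
  shows "multilinear_form d m F x = (\<Sum>i\<in>{1..m j}. partial_form d m F x j i * x j i)"
  using sum_entries_weighted[OF assms, where F = F and x = x and m = m and h = "\<lambda>_. 1"] by (simp add: multilinear_form_def)

lemma partial_form_upd: "partial_form d m F (x(j := v)) j i = partial_form d m F x j i"
  unfolding partial_form_def by (intro sum.cong prod.cong arg_cong[where f = "(*) _"] refl) auto

lemma partial_form_pos: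
  assumes "nonneg_tensor d m F" "nonneg_tuple d m x" "j \<in> {1..d}" "e \<in> multi_indices d m"
    "F e > 0" "\<And>l. l \<in> {1..d} - {j} \<Longrightarrow> x l (e l) > 0"
  shows "partial_form d m F x j (e j) > 0"
proof -
  let ?E = "\<Pi>\<^sub>E l\<in>{1..d} - {j}. {1..m l}"
  let ?r = "restrict e ({1..d} - {j})"
  have r: "?r \<in> ?E" using assms(4) by (auto simp: multi_indices_def)
  have upd: "?r(j := e j) = e"
    using assms(3,4) by (auto simp: multi_indices_def fun_eq_iff PiE_def extensional_def)
  have nonneg: "F (a(j := e j)) * (\<Prod>l\<in>{1..d} - {j}. x l (a l)) \<ge> 0" if a: "a \<in> ?E" for a
  proof (intro mult_nonneg_nonneg prod_nonneg ballI)
    have "a(j := e j) \<in> (\<Pi>\<^sub>E l\<in>insert j ({1..d} - {j}). {1..m l})"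
      using a multi_indices_nth[OF assms(4,3)] by (simp only: PiE_insert_eq) auto
    then show "F (a(j := e j)) \<ge> 0"
      using assms(1,3) by (simp add: nonneg_tensor_def multi_indices_def insert_absorb)
    fix l assume "l \<in> {1..d} - {j}"
    with a assms(2) show "x l (a l) \<ge> 0"
      by (auto simp: nonneg_tuple_def dest!: PiE_mem)
  qed
  have "0 < F (?r(j := e j)) * (\<Prod>l\<in>{1..d} - {j}. x l (?r l))"
    unfolding upd using assms(5,6) by (intro mult_pos_pos prod_pos) auto
  then show ?thesis
    unfolding partial_form_def using r nonneg
    by (intro sum_pos2[of _ ?r]) (auto intro!: finite_PiE)
qed

subsection \<open>Connectedness\<close>

text \<open>Stated on positive entries rather than on arcs of the graph, so that it can be tested
  one monomial at a time.\<close>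

definition link_closed :: "nat \<Rightarrow> (nat \<Rightarrow> nat) \<Rightarrow> ((nat \<Rightarrow> nat) \<Rightarrow> real) \<Rightarrow> (nat \<times> nat) set \<Rightarrow> bool" where
  "link_closed d m F A \<longleftrightarrow> (\<forall>e\<in>multi_indices d m. F e > 0 \<longrightarrow>
     (\<forall>k\<in>{1..d}. \<forall>l\<in>{1..d}. (k, e k) \<in> A \<longrightarrow> (l, e l) \<in> A))"

text \<open>The common consequence of weak irreducibility and irreducibility on which existence and
  uniqueness of the positive solution rest.\<close>

definition linked :: "nat \<Rightarrow> (nat \<Rightarrow> nat) \<Rightarrow> ((nat \<Rightarrow> nat) \<Rightarrow> real) \<Rightarrow> bool" where
  "linked d m F \<longleftrightarrow> (\<forall>A. A \<subseteq> tensor_vertices d m \<longrightarrow> A \<noteq> {} \<longrightarrow> link_closed d m F A \<longrightarrow>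
     A = tensor_vertices d m)"

text \<open>Every vertex is reachable from one in \<open>A\<close>, and each arc joins two indices
  of one positive entry, so membership in \<open>A\<close> propagates along the walk.\<close>

lemma weakly_irreducible_imp_linked:
  assumes "weakly_irreducible d m F"
  shows "linked d m F"
  unfolding linked_def
proof (intro allI impI)
  fix A assume A: "A \<subseteq> tensor_vertices d m" "A \<noteq> {}" "link_closed d m F A"
  let ?G = "with_proj (tensor_graph d m F)"
  obtain v where v: "v \<in> A" using A(2) by blast
  have "w \<in> A" if w: "w \<in> tensor_vertices d m" for w
  proof -
    have "v \<rightarrow>\<^sup>*\<^bsub>mk_symmetric ?G\<^esub> w"
      using assms v w A(1)
      by (auto simp: weakly_irreducible_def connected_def strongly_connected_def tensor_graph_def)
    then show "w \<in> A"
      unfolding reachable_def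
    proof (induction rule: rtrancl_on_induct)
      case (step a b)
      then have "(a, b) \<in> parcs (tensor_graph d m F) \<or> (b, a) \<in> parcs (tensor_graph d m F)"
        by (auto simp: parcs_mk_symmetric)
      then obtain k l e where "k \<in> {1..d}" "l \<in> {1..d}" "e \<in> multi_indices d m" "F e > 0"
        "a = (k, e k)" "b = (l, e l)"
        unfolding tensor_graph_def by auto
      then show ?case
        using step.IH A(3) unfolding link_closed_def by blast
    qed (rule v)
  qed
  then show "A = tensor_vertices d m" using A(1) by blast
qed

text \<open>For a proper \<open>A\<close>, irreducibility yields a positive entry with exactly one
  index in \<open>A\<close>; since \<open>d >= 2\<close> it has another index, outside
  \<open>A\<close>, so \<open>A\<close> is not closed.\<close>

lemma irreducible_imp_linked:
  assumes "d \<ge> 2" "irreducible_tensor d m F"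
  shows "linked d m F"
  unfolding linked_def
proof (intro allI impI, rule ccontr)
  fix A assume A: "A \<subseteq> tensor_vertices d m" "A \<noteq> {}" "link_closed d m F A"
    "A \<noteq> tensor_vertices d m"
  then obtain k e where ke: "k \<in> {1..d}" "e \<in> multi_indices d m" "(k, e k) \<in> A" "F e > 0"
    "\<forall>j\<in>{1..d} - {k}. (j, e j) \<in> tensor_vertices d m - A"
    using assms(2) unfolding irreducible_tensor_def by (metis psubsetI)
  have "(if k = 1 then 2 else 1) \<in> {1..d} - {k}" using assms(1) by auto
  then obtain l where l: "l \<in> {1..d}" "l \<noteq> k" by blast
  then have "(l, e l) \<in> A" using ke(1-4) A(3) unfolding link_closed_def by blast
  moreover have "(l, e l) \<notin> A" using ke(5) l by blast
  ultimately show False by contradiction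
qed

subsection \<open>Unit tuples\<close>

definition unit_tuples :: "nat \<Rightarrow> (nat \<Rightarrow> nat) \<Rightarrow> (nat \<Rightarrow> real) \<Rightarrow> (nat \<Rightarrow> nat \<Rightarrow> real) set" where
  "unit_tuples d m p = {x \<in> vector_tuples d m. nonneg_tuple d m x \<and>
     (\<forall>j\<in>{1..d}. p_norm (p j) (m j) (x j) = 1)}"

lemma p_norm_eq_1_iff:
  assumes "p > 0" "\<And>i. i \<in> {1..n} \<Longrightarrow> u i \<ge> 0"
  shows "p_norm p n u = 1 \<longleftrightarrow> (\<Sum>i\<in>{1..n}. u i powr p) = 1"
proof -
  have "(\<Sum>i\<in>{1..n}. \<bar>u i\<bar> powr p) = (\<Sum>i\<in>{1..n}. u i powr p)"
    using assms(2) by (intro sum.cong) auto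
  moreover have "(\<Sum>i\<in>{1..n}. u i powr p) \<ge> 0" by (intro sum_nonneg) auto
  moreover have "s powr (1 / p) = 1 \<longleftrightarrow> s = 1" if "s \<ge> 0" for s
    using that assms(1) by (cases "s = 0") (auto simp: powr_def)
  ultimately show ?thesis by (simp add: p_norm_def)
qed

lemma is_solution_iff:
  "is_solution d m p F x \<longleftrightarrow> x \<in> unit_tuples d m p \<and>
     (\<exists>mu. \<forall>j\<in>{1..d}. \<forall>i\<in>{1..m j}. partial_form d m F x j i = mu * x j i powr (p j - 1))"
  unfolding is_solution_def unit_tuples_def by blast

lemma tuple_eqI:
  assumes "x \<in> vector_tuples d m" "y \<in> vector_tuples d m"
    and "\<And>j i. j \<in> {1..d} \<Longrightarrow> i \<in> {1..m j} \<Longrightarrow> x j i = y j i"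
  shows "x = y"
proof (rule PiE_ext)
  fix j assume j: "j \<in> {1..d}"
  show "x j = y j"
  proof (rule PiE_ext)
    show "x j \<in> (\<Pi>\<^sub>E i\<in>{1..m j}. UNIV)" "y j \<in> (\<Pi>\<^sub>E i\<in>{1..m j}. UNIV)"
      using assms(1,2) j unfolding vector_tuples_def by (auto dest: PiE_mem)
  qed (rule assms(3)[OF j])
qed (use assms(1,2) in \<open>simp_all add: vector_tuples_def\<close>)

locale nonneg_multilinear =
  fixes d :: nat and m :: "nat \<Rightarrow> nat" and p :: "nat \<Rightarrow> real" and F :: "(nat \<Rightarrow> nat) \<Rightarrow> real"
  assumes d_pos: "d \<ge> 1" and m_pos: "j \<in> {1..d} \<Longrightarrow> m j \<ge> 1"
    and F_nonneg: "nonneg_tensor d m F"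
    and p_pos: "j \<in> {1..d} \<Longrightarrow> p j > 1"
    and p_ge: "j \<in> {1..d} \<Longrightarrow> p j \<ge> real d"
begin

lemma F_ge_0: "e \<in> multi_indices d m \<Longrightarrow> F e \<ge> 0"
  using F_nonneg by (simp add: nonneg_tensor_def)

text \<open>The condition \<open>p j >= d\<close> enters here: it makes the exponents
  \<open>1 / p j\<close> admissible weights for AM-GM and bounds by 1 the degree of the monomials in
  the powers \<open>x j i powr p j\<close>.\<close>

lemma sum_inverse_p_le_1: "(\<Sum>j\<in>{1..d}. 1 / p j) \<le> 1"
proof -
  have "(\<Sum>j\<in>{1..d}. 1 / p j) \<le> (\<Sum>j\<in>{1..d}. 1 / real d)"
    using p_ge d_pos by (intro sum_mono divide_left_mono mult_pos_pos) (force dest: p_pos)+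
  also have "\<dots> = 1" using d_pos by simp
  finally show ?thesis .
qed

lemma unit_tuples_iff:
  "x \<in> unit_tuples d m p \<longleftrightarrow> x \<in> vector_tuples d m \<and>
     (\<forall>j\<in>{1..d}. \<forall>i\<in>{1..m j}. x j i \<ge> 0) \<and>
     (\<forall>j\<in>{1..d}. (\<Sum>i\<in>{1..m j}. x j i powr p j) = 1)"
proof -
  have "p_norm (p j) (m j) (x j) = 1 \<longleftrightarrow> (\<Sum>i\<in>{1..m j}. x j i powr p j) = 1"
    if "nonneg_tuple d m x" "j \<in> {1..d}" for j
    using that p_pos[OF that(2)] by (intro p_norm_eq_1_iff) (auto simp: nonneg_tuple_def)
  then show ?thesis
    unfolding unit_tuples_def nonneg_tuple_def by blast
qed

lemma unit_tuples_bounds: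
  assumes "x \<in> unit_tuples d m p" "j \<in> {1..d}" "i \<in> {1..m j}"
  shows "0 \<le> x j i" "x j i \<le> 1"
proof -
  show x: "0 \<le> x j i" using assms by (auto simp: unit_tuples_iff)
  have "x j i powr p j \<le> (\<Sum>i\<in>{1..m j}. x j i powr p j)"
    using assms(3) by (intro member_le_sum) auto
  also have "\<dots> = 1" using assms by (auto simp: unit_tuples_iff)
  finally have "x j i powr p j \<le> 1" .
  then show "x j i \<le> 1"
    using gr_one_powr[of "x j i" "p j"] p_pos[OF assms(2)] by linarith
qed

text \<open>The normalisation prevents a whole mode from vanishing, so the zero set of a unit tuple
  that is not positive is an admissible test set for \<open>linked\<close> and for
  irreducibility.\<close>

lemma unit_tuple_zero_set:
  assumes x: "x \<in> unit_tuples d m p" and "\<not> positive_tuple d m x"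
  defines "Z \<equiv> {(j, i) \<in> tensor_vertices d m. x j i = 0}"
  shows "Z \<noteq> {}" "Z \<subset> tensor_vertices d m"
proof -
  show "Z \<noteq> {}"
    using assms(2) unit_tuples_bounds(1)[OF x]
    by (force simp: positive_tuple_def Z_def tensor_vertices_def)
  have "Z \<noteq> tensor_vertices d m"
  proof
    assume "Z = tensor_vertices d m"
    then have "x 1 i = 0" if "i \<in> {1..m 1}" for i
      using that d_pos by (force simp: Z_def tensor_vertices_def)
    moreover have "(\<Sum>i\<in>{1..m 1}. x 1 i powr p 1) = 1"
      using x d_pos by (simp add: unit_tuples_iff)
    ultimately show False by simp
  qed
  then show "Z \<subset> tensor_vertices d m" by (auto simp: Z_def)
qed

text \<open>Perturbed tuples are given by formulas for all arguments; restricting makes them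
  extensional, and \<open>multilinear_form_restrict\<close> shows that the form does not
  notice.\<close>

lemma restrict_unit_tuple:
  assumes "\<And>j i. j \<in> {1..d} \<Longrightarrow> i \<in> {1..m j} \<Longrightarrow> y j i \<ge> 0"
    and "\<And>j. j \<in> {1..d} \<Longrightarrow> (\<Sum>i\<in>{1..m j}. y j i powr p j) = 1"
  shows "(\<lambda>j\<in>{1..d}. \<lambda>i\<in>{1..m j}. y j i) \<in> unit_tuples d m p"
  using assms by (auto simp: unit_tuples_iff vector_tuples_def)

lemma multilinear_form_restrict:
  "multilinear_form d m F (\<lambda>j\<in>{1..d}. \<lambda>i\<in>{1..m j}. y j i) = multilinear_form d m F y"
  unfolding multilinear_form_def
  by (intro sum.cong prod.cong arg_cong[where f = "(*) _"] refl) (use multi_indices_nth in simp)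

text \<open>A closed subset of the compact cube with entries in [0,1]; continuity of the power sums
  at zero entries relies on positive exponents.\<close>

lemma compact_unit_tuples: "compact (unit_tuples d m p)"
proof -
  let ?K = "\<Pi>\<^sub>E j\<in>{1..d}. \<Pi>\<^sub>E i\<in>{1..m j}. {0..1::real}"
  let ?s = "\<lambda>j x. \<Sum>i\<in>{1..m j}. x j i powr p j"
  have K: "compact ?K" by (intro compact_PiE) auto
  have x0: "x j i \<ge> 0" if "x \<in> ?K" "j \<in> {1..d}" "i \<in> {1..m j}" for x j i
    using PiE_mem[OF PiE_mem[OF that(1,2)] that(3)] by simp
  have cont: "continuous_on ?K (?s j)" if j: "j \<in> {1..d}" for j
    using x0 j p_pos[OF j]
    by (intro continuous_on_sum continuous_on_powr' continuous_on_entry continuous_on_const)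
       (auto simp: less_trans[OF zero_less_one])
  have "closedin (top_of_set ?K) (?K \<inter> ?s j -` {1})" if "j \<in> {1..d}" for j
    by (intro continuous_closedin_preimage cont that) auto
  then have "closedin (top_of_set ?K) (\<Inter>j\<in>{1..d}. ?K \<inter> ?s j -` {1})"
    using d_pos by (intro closedin_INT) auto
  moreover have "unit_tuples d m p = (\<Inter>j\<in>{1..d}. ?K \<inter> ?s j -` {1})"
  proof (intro subset_antisym subsetI)
    fix x assume x: "x \<in> unit_tuples d m p"
    have "x j \<in> (\<Pi>\<^sub>E i\<in>{1..m j}. {0..1})" if j: "j \<in> {1..d}" for j
    proof -
      have "x j \<in> (\<Pi>\<^sub>E i\<in>{1..m j}. UNIV)"
        using x j by (auto simp: unit_tuples_iff vector_tuples_def)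
      then show ?thesis
        using unit_tuples_bounds[OF x j] by (simp add: PiE_iff)
    qed
    then have "x \<in> ?K"
      using x by (simp add: PiE_iff unit_tuples_iff vector_tuples_def)
    then show "x \<in> (\<Inter>j\<in>{1..d}. ?K \<inter> ?s j -` {1})"
      using x by (auto simp: unit_tuples_iff)
  next
    fix x assume x: "x \<in> (\<Inter>j\<in>{1..d}. ?K \<inter> ?s j -` {1})"
    then have xK: "x \<in> ?K" using d_pos by auto
    then have "x \<in> vector_tuples d m"
      unfolding vector_tuples_def by (simp add: PiE_iff)
    then show "x \<in> unit_tuples d m p"
      using x x0[OF xK] by (auto simp: unit_tuples_iff)
  qed
  ultimately have "closedin (top_of_set ?K) (unit_tuples d m p)" by (simp only:)
  then show ?thesis by (rule closedin_compact[OF K])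
qed

section \<open>Existence: a maximiser of the form, its positivity and the system (S)\<close>

lemma maximiser_exists:
  obtains x where "x \<in> unit_tuples d m p"
    "\<And>y. y \<in> unit_tuples d m p \<Longrightarrow> multilinear_form d m F y \<le> multilinear_form d m F x"
proof -
  \<comment> \<open>The barycentre of the simplices of \<open>p j\<close>-th powers shows that the
    feasible set is nonempty.\<close>
  have "(\<lambda>j\<in>{1..d}. \<lambda>i\<in>{1..m j}. (1 / real (m j)) powr (1 / p j)) \<in> unit_tuples d m p"
  proof (rule restrict_unit_tuple)
    fix j assume j: "j \<in> {1..d}"
    show "(\<Sum>i\<in>{1..m j}. ((1 / real (m j)) powr (1 / p j)) powr p j) = 1"
      using p_pos[OF j] m_pos[OF j] by (simp add: powr_powr)
  qed simp
  then have "unit_tuples d m p \<noteq> {}" by blast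
  moreover have "continuous_on (unit_tuples d m p) (multilinear_form d m F)"
    unfolding multilinear_form_def[abs_def]
    by (intro continuous_on_sum continuous_on_mult continuous_on_prod continuous_on_const
        continuous_on_entry)
  ultimately obtain x where "x \<in> unit_tuples d m p"
    "\<forall>y\<in>unit_tuples d m p. multilinear_form d m F y \<le> multilinear_form d m F x"
    using continuous_attains_sup[OF compact_unit_tuples] by blast
  then show ?thesis using that by blast
qed

lemma maximiser_pos:
  assumes linked: "linked d m F" and x: "x \<in> unit_tuples d m p"
    and max: "\<And>y. y \<in> unit_tuples d m p \<Longrightarrow> multilinear_form d m F y \<le> multilinear_form d m F x"
  shows "positive_tuple d m x"
proof (rule ccontr)
  assume "\<not> positive_tuple d m x"
  define Z where "Z = {(j, i) \<in> tensor_vertices d m. x j i = 0}"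
  have x_ge: "x j i \<ge> 0" if "j \<in> {1..d}" "i \<in> {1..m j}" for j i
    using unit_tuples_bounds[OF x that] by simp
  have x_sum: "(\<Sum>i\<in>{1..m j}. x j i powr p j) = 1" if "j \<in> {1..d}" for j
    using x that by (simp add: unit_tuples_iff)
  have "\<not> link_closed d m F Z"
    using unit_tuple_zero_set[OF x \<open>\<not> positive_tuple d m x\<close>] linked
    unfolding linked_def Z_def by blast
  \<comment> \<open>An entry whose monomial has a vanishing factor in mode \<open>k\<close> and a
    positive factor in mode \<open>l\<close>.\<close>
  then obtain e k l where e: "e \<in> multi_indices d m" "F e > 0" and k: "k \<in> {1..d}"
    and l: "l \<in> {1..d}" and "(k, e k) \<in> Z" "(l, e l) \<notin> Z"
    by (auto simp: link_closed_def)
  then have xk: "x k (e k) = 0" and "x l (e l) \<noteq> 0"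
    using multi_indices_nth[OF e(1) l] by (auto simp: Z_def tensor_vertices_def)
  then have xl: "x l (e l) > 0"
    using x_ge[OF l multi_indices_nth[OF e(1) l]] by simp
  \<comment> \<open>In the coordinates \<open>x j i powr p j\<close> this is the segment from
    \<open>x\<close> to the barycentre, whose entries are \<open>1 / m j\<close>; it stays in the
    simplices.\<close>
  define y where "y = (\<lambda>t j i. ((1 - t) * x j i powr p j + t / m j) powr (1 / p j))"
  define M where "M = multilinear_form d m F x"
  \<comment> \<open>Mode \<open>l\<close> is left out because its factor stays bounded away from 0
    along the segment; this is what makes the exponent of \<open>t\<close> smaller than 1.\<close>
  define s where "s = (\<Sum>j\<in>{1..d} - {l}. 1 / p j)"
  \<comment> \<open>The lower bound for the monomial of \<open>e\<close> with
    \<open>t powr s\<close> removed: at least half of the mass at \<open>(l, e l)\<close> survives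
    for \<open>t <= 1 / 2\<close>, and every other factor keeps at least its share
    \<open>t / m j\<close> of the barycentre.\<close>
  define C where "C = (x l (e l) powr p l / 2) powr (1 / p l)
    * (\<Prod>j\<in>{1..d} - {l}. (1 / m j) powr (1 / p j))"
  have C: "C > 0"
    unfolding C_def using xl m_pos by (intro mult_pos_pos prod_pos) fastforce+
  have s: "s < 1"
  proof -
    have "1 / p l + s \<le> 1"
      using sum_inverse_p_le_1 sum.remove[OF finite_atLeastAtMost l, of "\<lambda>j. 1 / p j"]
      by (simp add: s_def)
    moreover have "1 / p l > 0" using p_pos[OF l] by simp
    ultimately show ?thesis by linarith
  qed
  \<comment> \<open>The right-hand side bounds the loss; the left-hand side bounds from below the
    gain from the monomial of \<open>e\<close>, which is zero at \<open>x\<close>.\<close>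
  have key: "F e * C * t powr s \<le> t * M" if t: "0 < t" "t \<le> 1 / 2" for t
  proof -
    have y_unit: "(\<lambda>j\<in>{1..d}. \<lambda>i\<in>{1..m j}. y t j i) \<in> unit_tuples d m p"
    proof (rule restrict_unit_tuple)
      fix j assume j: "j \<in> {1..d}"
      have "(\<Sum>i\<in>{1..m j}. y t j i powr p j) = (\<Sum>i\<in>{1..m j}. (1 - t) * x j i powr p j + t / m j)"
        using p_pos[OF j] t by (intro sum.cong) (auto simp: y_def powr_powr)
      also have "\<dots> = (1 - t) * (\<Sum>i\<in>{1..m j}. x j i powr p j) + t"
        using m_pos[OF j] by (simp add: sum.distrib sum_distrib_left)
      finally show "(\<Sum>i\<in>{1..m j}. y t j i powr p j) = 1" using x_sum[OF j] by simp
    qed (simp add: y_def)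
    have y_ge0: "y t j i \<ge> 0" for j i by (simp add: y_def)
    have y_ge_x: "(1 - t) powr (1 / p j) * x j i \<le> y t j i"
      if j: "j \<in> {1..d}" and i: "i \<in> {1..m j}" for j i
    proof -
      have "(1 - t) powr (1 / p j) * x j i = ((1 - t) * x j i powr p j) powr (1 / p j)"
        using p_pos[OF j] t x_ge[OF j i] by (simp add: powr_mult powr_powr)
      also have "\<dots> \<le> y t j i"
        using p_pos[OF j] t unfolding y_def by (intro powr_mono2) auto
      finally show ?thesis .
    qed
    have y_ge_t: "(1 / m j) powr (1 / p j) * t powr (1 / p j) \<le> y t j i" if j: "j \<in> {1..d}" for j i
    proof -
      have "(1 / m j) powr (1 / p j) * t powr (1 / p j) = (t / m j) powr (1 / p j)"
        using t by (simp flip: powr_mult)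
      also have "\<dots> \<le> y t j i"
        using p_pos[OF j] t unfolding y_def by (intro powr_mono2) auto
      finally show ?thesis .
    qed
    \<comment> \<open>Scaling the powers by \<open>1 - t\<close> scales a monomial by
      \<open>1 - t\<close> raised to the sum of the \<open>1 / p j\<close>, which is at least
      \<open>1 - t\<close> because that sum is at most 1.\<close>
    have term_x: "(1 - t) * (\<Prod>j\<in>{1..d}. x j (a j)) \<le> (\<Prod>j\<in>{1..d}. y t j (a j))"
      if a: "a \<in> multi_indices d m" for a
    proof -
      have a_in: "a j \<in> {1..m j}" if "j \<in> {1..d}" for j using multi_indices_nth[OF a that] .
      have "(1 - t) powr 1 \<le> (1 - t) powr (\<Sum>j\<in>{1..d}. 1 / p j)"
        using t sum_inverse_p_le_1 by (intro powr_mono') auto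
      also have "\<dots> = (\<Prod>j\<in>{1..d}. (1 - t) powr (1 / p j))"
        using t by (intro powr_sum) auto
      finally have "(1 - t) * (\<Prod>j\<in>{1..d}. x j (a j))
          \<le> (\<Prod>j\<in>{1..d}. (1 - t) powr (1 / p j)) * (\<Prod>j\<in>{1..d}. x j (a j))"
        using t x_ge a_in by (intro mult_right_mono prod_nonneg) auto
      also have "\<dots> = (\<Prod>j\<in>{1..d}. (1 - t) powr (1 / p j) * x j (a j))"
        by (simp only: prod.distrib)
      also have "\<dots> \<le> (\<Prod>j\<in>{1..d}. y t j (a j))"
        using y_ge_x x_ge a_in by (intro prod_mono) auto
      finally show ?thesis .
    qed
    have term_e: "C * t powr s \<le> (\<Prod>j\<in>{1..d}. y t j (e j))"
    proof -
      have "x l (e l) powr p l / 2 \<le> (1 - t) * x l (e l) powr p l + t / m l"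
        using t mult_right_mono[of "1 / 2" "1 - t" "x l (e l) powr p l"]
        by (simp add: add_increasing2)
      then have "(x l (e l) powr p l / 2) powr (1 / p l) \<le> y t l (e l)"
        using p_pos[OF l] unfolding y_def by (intro powr_mono2) auto
      moreover have "(\<Prod>j\<in>{1..d} - {l}. (1 / m j) powr (1 / p j) * t powr (1 / p j))
          \<le> (\<Prod>j\<in>{1..d} - {l}. y t j (e j))"
        using y_ge_t by (intro prod_mono) auto
      moreover have "t powr s = (\<Prod>j\<in>{1..d} - {l}. t powr (1 / p j))"
        unfolding s_def using t by (intro powr_sum) auto
      ultimately show ?thesis
        unfolding C_def prod.remove[OF finite_atLeastAtMost l, of "\<lambda>j. y t j (e j)"] mult.assoc
        by (intro mult_mono) (auto simp: prod.distrib y_ge0 intro!: mult_nonneg_nonneg prod_nonneg)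
    qed
    have Pe: "(\<Prod>j\<in>{1..d}. x j (e j)) = 0" using k xk by auto
    \<comment> \<open>As the monomial of \<open>e\<close> vanishes at \<open>x\<close>, the bound
      for its new value can be added to \<open>(1 - t) * M\<close> without double counting.\<close>
    have "(1 - t) * M + F e * (C * t powr s)
        = (\<Sum>a\<in>multi_indices d m. F a * ((1 - t) * (\<Prod>j\<in>{1..d}. x j (a j)))
            + (if a = e then F e * (C * t powr s) else 0))"
    proof -
      have "(\<Sum>a\<in>multi_indices d m. F a * ((1 - t) * (\<Prod>j\<in>{1..d}. x j (a j)))) = (1 - t) * M"
        unfolding M_def multilinear_form_def sum_distrib_left by (intro sum.cong refl) (rule mult.left_commute)
      then show ?thesis using e(1) by (simp add: sum.distrib)
    qed
    also have "\<dots> \<le> multilinear_form d m F (y t)"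
      unfolding multilinear_form_def
    proof (rule sum_mono)
      fix a assume a: "a \<in> multi_indices d m"
      show "F a * ((1 - t) * (\<Prod>j\<in>{1..d}. x j (a j))) + (if a = e then F e * (C * t powr s) else 0)
          \<le> F a * (\<Prod>j\<in>{1..d}. y t j (a j))"
      proof (cases "a = e")
        case True
        then show ?thesis
          using mult_left_mono[OF term_e, of "F e"] e(2) by (simp only: Pe) simp
      next
        case False
        then show ?thesis
          using mult_left_mono[OF term_x[OF a] F_ge_0[OF a]] by simp
      qed
    qed
    also have "\<dots> \<le> M"
      using max[OF y_unit] by (simp only: multilinear_form_restrict M_def)
    finally show ?thesis by (simp add: algebra_simps)
  qed
  have "((\<lambda>t. t powr (1 - s) * M) \<longlongrightarrow> 0 powr (1 - s) * M) (at_right 0)"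
    using s by (intro tendsto_mult tendsto_powr' tendsto_ident_at tendsto_const)
      (auto simp: eventually_at_filter)
  \<comment> \<open>This is \<open>key\<close> divided by \<open>t powr s\<close>; since
    \<open>s < 1\<close>, the right-hand side tends to 0 with \<open>t\<close>.\<close>
  moreover have "\<forall>\<^sub>F t in at_right 0. F e * C \<le> t powr (1 - s) * M"
  proof (rule eventually_mono)
    show "\<forall>\<^sub>F t in at_right 0. t \<in> {0<..<1 / 2 :: real}"
      by (rule eventually_at_right_real) simp
    fix t :: real assume t: "t \<in> {0<..<1 / 2}"
    have "F e * C * t powr s \<le> t powr (1 - s) * M * t powr s"
      using key[of t] t by (simp add: mult.commute mult.left_commute flip: powr_add)
    then show "F e * C \<le> t powr (1 - s) * M" using t by (simp add: mult_le_cancel_right)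
  qed
  ultimately have "F e * C \<le> 0 powr (1 - s) * M"
    by (intro tendsto_lowerbound) auto
  then show False using C e(2) by (simp add: mult_le_0_iff)
qed

text \<open>Moves mass between two coordinates of \<open>x\<^sub>j\<close> inside the simplex of \<open>p\<^sub>j\<close>-th powers.\<close>

lemma maximiser_first_order:
  assumes x: "x \<in> unit_tuples d m p" and pos: "positive_tuple d m x"
    and max: "\<And>y. y \<in> unit_tuples d m p \<Longrightarrow> multilinear_form d m F y \<le> multilinear_form d m F x"
    and j: "j \<in> {1..d}" and a: "a \<in> {1..m j}" and b: "b \<in> {1..m j}" and "a \<noteq> b"
  shows "partial_form d m F x j a * x j a powr (1 - p j) = partial_form d m F x j b * x j b powr (1 - p j)"
proof -
  let ?c = "partial_form d m F x j"
  define q where "q = 1 / p j"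
  define u where "u = (\<lambda>i. x j i powr p j)"
  have pj: "p j > 1" using p_pos[OF j] .
  have xpos: "x j i > 0" if "i \<in> {1..m j}" for i using pos j that by (auto simp: positive_tuple_def)
  have upos: "u i > 0" if "i \<in> {1..m j}" for i using xpos[OF that] by (simp add: u_def)
  have uq: "u i powr q = x j i" if "i \<in> {1..m j}" for i
    using xpos[OF that] pj by (simp add: u_def q_def powr_powr)
  have split: "(\<Sum>i\<in>{1..m j}. g i) = g a + (g b + (\<Sum>i\<in>{1..m j} - {a} - {b}. g i))" for g :: "nat \<Rightarrow> real"
    using a b \<open>a \<noteq> b\<close> by (subst sum.remove[of _ a], simp, simp, subst sum.remove[of _ b]) auto
  \<comment> \<open>The part of the form that varies when mass \<open>t\<close> passes from
    \<open>u b\<close> to \<open>u a\<close>; the other modes are fixed, so the rest is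
    constant.\<close>
  define h where "h = (\<lambda>t. ?c a * (u a + t) powr q + ?c b * (u b - t) powr q)"
  have h_le: "h t \<le> h 0" if t: "\<bar>0 - t\<bar> < min (u a) (u b)" for t
  proof -
    define v where "v = (x j)(a := (u a + t) powr q, b := (u b - t) powr q)"
    have v_ab: "v a = (u a + t) powr q" "v b = (u b - t) powr q" using \<open>a \<noteq> b\<close> by (auto simp: v_def)
    have rest: "(\<Sum>i\<in>{1..m j} - {a} - {b}. g i (v i)) = (\<Sum>i\<in>{1..m j} - {a} - {b}. g i (x j i))"
      for g :: "nat \<Rightarrow> real \<Rightarrow> real"
      by (intro sum.cong) (auto simp: v_def)
    have "v a powr p j = u a + t" "v b powr p j = u b - t"
      unfolding v_ab q_def using t pj by (auto simp: powr_powr)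
    then have "(\<Sum>i\<in>{1..m j}. v i powr p j) = (\<Sum>i\<in>{1..m j}. x j i powr p j)"
      unfolding split[of "\<lambda>i. v i powr p j"] split[of "\<lambda>i. x j i powr p j"]
      using rest[of "\<lambda>_ z. z powr p j"] by (simp add: u_def)
    moreover have "v i \<ge> 0" if "i \<in> {1..m j}" for i
      using xpos[OF that] by (simp add: v_def)
    moreover have "x(j := v) \<in> vector_tuples d m"
      using x j a b by (auto simp: unit_tuples_iff vector_tuples_def v_def PiE_iff extensional_def)
    ultimately have "x(j := v) \<in> unit_tuples d m p"
      using x j by (auto simp: unit_tuples_iff)
    then have "multilinear_form d m F (x(j := v)) \<le> multilinear_form d m F x" by (rule max)
    then have "(\<Sum>i\<in>{1..m j}. ?c i * v i) \<le> (\<Sum>i\<in>{1..m j}. ?c i * x j i)"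
      by (simp add: multilinear_form_expand[OF j] partial_form_upd)
    then have "?c a * v a + ?c b * v b \<le> ?c a * x j a + ?c b * x j b"
      unfolding split[of "\<lambda>i. ?c i * v i"] split[of "\<lambda>i. ?c i * x j i"]
      using rest[of "\<lambda>i z. ?c i * z"] by simp
    then show ?thesis by (simp add: h_def v_ab uq[OF a] uq[OF b])
  qed
  \<comment> \<open>\<open>h\<close> has a local maximum at 0, so this derivative vanishes; the
    factor \<open>q\<close> cancels and \<open>u i powr (q - 1)\<close> equals
    \<open>x j i powr (1 - p j)\<close>.\<close>
  have deriv: "(h has_real_derivative ?c a * (q * u a powr (q - 1)) - ?c b * (q * u b powr (q - 1))) (at 0)"
    unfolding h_def using upos[OF a] upos[OF b]
    by (auto intro!: derivative_eq_intros simp: powr_diff field_simps)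
  then have "?c a * (q * u a powr (q - 1)) - ?c b * (q * u b powr (q - 1)) = 0"
    using DERIV_local_max[OF deriv, of "min (u a) (u b)"] upos[OF a] upos[OF b] h_le by simp
  moreover have "u i powr (q - 1) = x j i powr (1 - p j)" if "i \<in> {1..m j}" for i
    using pj by (simp add: u_def q_def powr_powr right_diff_distrib)
  ultimately show ?thesis using a b pj by (simp add: q_def)
qed

text \<open>The first-order conditions give one multiplier per mode. Multiplying by
  \<open>x j i\<close> and summing over \<open>i\<close> identifies each multiplier with the value
  of the form, so a single scalar serves all modes.\<close>

lemma maximiser_is_solution:
  assumes x: "x \<in> unit_tuples d m p" and pos: "positive_tuple d m x"
    and max: "\<And>y. y \<in> unit_tuples d m p \<Longrightarrow> multilinear_form d m F y \<le> multilinear_form d m F x"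
  shows "is_solution d m p F x"
  unfolding is_solution_iff
proof (intro conjI exI ballI)
  fix j i assume j: "j \<in> {1..d}" and i: "i \<in> {1..m j}"
  define mu where "mu = partial_form d m F x j i * x j i powr (1 - p j)"
  have eq: "partial_form d m F x j k = mu * x j k powr (p j - 1)" if k: "k \<in> {1..m j}" for k
  proof -
    have "x j k > 0" using pos j k by (auto simp: positive_tuple_def)
    then have "x j k powr (1 - p j) * x j k powr (p j - 1) = 1" by (simp flip: powr_add)
    moreover have "mu = partial_form d m F x j k * x j k powr (1 - p j)"
      using maximiser_first_order[OF x pos max j i k] by (cases "i = k") (auto simp: mu_def)
    ultimately show ?thesis by (simp add: mult.assoc)
  qed
  have "multilinear_form d m F x = (\<Sum>k\<in>{1..m j}. mu * x j k powr p j)"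
    unfolding multilinear_form_expand[OF j]
  proof (rule sum.cong)
    fix k assume k: "k \<in> {1..m j}"
    then have "x j k > 0" using pos j by (auto simp: positive_tuple_def)
    then have "x j k powr (p j - 1) * x j k = x j k powr p j"
      by (simp add: powr_diff)
    then show "partial_form d m F x j k * x j k = mu * x j k powr p j" by (simp add: eq[OF k])
  qed simp
  also have "\<dots> = mu" using x j by (simp add: unit_tuples_iff flip: sum_distrib_left)
  finally show "partial_form d m F x j i = multilinear_form d m F x * x j i powr (p j - 1)"
    using eq[OF i] by simp
qed (rule x)

lemma positive_solution_exists:
  assumes "linked d m F"
  obtains x where "is_solution d m p F x" "positive_tuple d m x"
proof -
  obtain x where "x \<in> unit_tuples d m p"
    "\<And>y. y \<in> unit_tuples d m p \<Longrightarrow> multilinear_form d m F y \<le> multilinear_form d m F x"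
    by (rule maximiser_exists) blast
  with that show ?thesis using maximiser_pos[OF assms] maximiser_is_solution by blast
qed

subsection \<open>Uniqueness\<close>

text \<open>Multiplying (S) by \<open>x j i\<close> gives \<open>mu * x j i powr p j\<close> on the
  right, where \<open>mu\<close> is the value of the form; the denominator cancels that
  power.\<close>

lemma solution_sum_entries:
  assumes x: "is_solution d m p F x" and pos: "positive_tuple d m x" and j: "j \<in> {1..d}"
  shows "(\<Sum>e\<in>multi_indices d m. F e * (\<Prod>l\<in>{1..d}. x l (e l)) * (h (e j) / x j (e j) powr p j))
    = multilinear_form d m F x * (\<Sum>i\<in>{1..m j}. h i)"
proof -
  obtain mu where mu: "\<And>i. i \<in> {1..m j} \<Longrightarrow> partial_form d m F x j i = mu * x j i powr (p j - 1)"
    using x j unfolding is_solution_iff by blast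
  have xpos: "x j i > 0" if "i \<in> {1..m j}" for i using pos j that by (auto simp: positive_tuple_def)
  have c: "partial_form d m F x j i * x j i = mu * x j i powr p j" if "i \<in> {1..m j}" for i
    using mu[OF that] xpos[OF that] by (simp add: powr_diff)
  have "multilinear_form d m F x = mu * (\<Sum>i\<in>{1..m j}. x j i powr p j)"
    by (simp add: multilinear_form_expand[OF j] c sum_distrib_left)
  then have mult: "multilinear_form d m F x = mu"
    using x j by (simp add: is_solution_iff unit_tuples_iff)
  have cancel: "partial_form d m F x j i * x j i * (h i / x j i powr p j) = mu * h i"
    if "i \<in> {1..m j}" for i
    using xpos[OF that] by (simp add: c[OF that])
  show ?thesis
    unfolding sum_entries_weighted[OF j, where h = "\<lambda>i. h i / x j i powr p j"] sum_distrib_left mult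
    by (intro sum.cong refl cancel)
qed

text \<open>Weighted AM-GM for the ratios of \<open>p j\<close>-th powers with weights
  \<open>1 / p j\<close>: their weighted geometric mean is the ratio of the two monomials.\<close>

lemma am_gm_entry:
  assumes "positive_tuple d m x" "positive_tuple d m y" "e \<in> multi_indices d m"
  defines "A \<equiv> (\<Sum>j\<in>{1..d}. 1 / p j * (y j (e j) powr p j / x j (e j) powr p j))
    + (1 - (\<Sum>j\<in>{1..d}. 1 / p j))"
  shows "(\<Prod>j\<in>{1..d}. y j (e j)) \<le> (\<Prod>j\<in>{1..d}. x j (e j)) * A"
    and "(\<Prod>j\<in>{1..d}. y j (e j)) = (\<Prod>j\<in>{1..d}. x j (e j)) * A \<Longrightarrow> j \<in> {1..d} \<Longrightarrow>
      y j (e j) powr p j / x j (e j) powr p j = A"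
proof -
  let ?r = "\<lambda>j. y j (e j) powr p j / x j (e j) powr p j"
  have xy: "x j (e j) > 0" "y j (e j) > 0" if "j \<in> {1..d}" for j
    using assms(1,2) multi_indices_nth[OF assms(3) that] that by (auto simp: positive_tuple_def)
  have w: "1 / p j > 0" if "j \<in> {1..d}" for j using p_pos[OF that] by simp
  have r: "?r j > 0" if "j \<in> {1..d}" for j using xy[OF that] by simp
  have "?r j powr (1 / p j) = y j (e j) / x j (e j)" if "j \<in> {1..d}" for j
    using xy[OF that] p_pos[OF that] by (simp add: powr_divide powr_powr)
  then have ratio: "(\<Prod>j\<in>{1..d}. ?r j powr (1 / p j)) = (\<Prod>j\<in>{1..d}. y j (e j)) / (\<Prod>j\<in>{1..d}. x j (e j))"
    by (simp add: prod_dividef)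
  have X: "(\<Prod>j\<in>{1..d}. x j (e j)) > 0" using xy by (intro prod_pos) auto
  note amgm = weighted_am_gm[of "{1..d}" "\<lambda>j. 1 / p j" ?r, OF _ w r sum_inverse_p_le_1 A_def[THEN meta_eq_to_obj_eq]]
  show "(\<Prod>j\<in>{1..d}. y j (e j)) \<le> (\<Prod>j\<in>{1..d}. x j (e j)) * A"
    using amgm(1) X by (simp only: ratio finite_atLeastAtMost) (simp add: field_simps)
  assume "(\<Prod>j\<in>{1..d}. y j (e j)) = (\<Prod>j\<in>{1..d}. x j (e j)) * A" "j \<in> {1..d}"
  moreover from this have "(\<Prod>j\<in>{1..d}. ?r j powr (1 / p j)) = A"
    by (simp only: ratio nonzero_mult_div_cancel_left[OF less_imp_neq[OF X, symmetric]])
  ultimately show "?r j = A" using amgm(2) by simp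
qed

lemma positive_solution_unique:
  assumes linked: "linked d m F"
    and x: "is_solution d m p F x" "positive_tuple d m x"
    and y: "is_solution d m p F y" "positive_tuple d m y"
  shows "x = y"
proof -
  define A where "A = (\<lambda>(x :: nat \<Rightarrow> nat \<Rightarrow> real) (y :: nat \<Rightarrow> nat \<Rightarrow> real) (e :: nat \<Rightarrow> nat). (\<Sum>j\<in>{1..d}. 1 / p j * (y j (e j) powr p j / x j (e j) powr p j))
    + (1 - (\<Sum>j\<in>{1..d}. 1 / p j)))"
  let ?P = "\<lambda>x e. \<Prod>j\<in>{1..d}. x j (e j)"
  \<comment> \<open>By \<open>solution_sum_entries\<close> each ratio averages to the value of the
    form at \<open>x\<close>, because the powers of \<open>y\<close> sum to 1 in every mode; the
    weights of these averages, deficit included, add up to 1.\<close>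
  have sum_A: "(\<Sum>e\<in>multi_indices d m. F e * (?P x e * A x y e)) = multilinear_form d m F x"
    if x: "is_solution d m p F x" "positive_tuple d m x" and y: "is_solution d m p F y" for x y
  proof -
    have "(\<Sum>e\<in>multi_indices d m. F e * (?P x e * A x y e))
        = (\<Sum>e\<in>multi_indices d m. (\<Sum>j\<in>{1..d}. 1 / p j * (F e * ?P x e * (y j (e j) powr p j / x j (e j) powr p j)))
            + F e * ?P x e * (1 - (\<Sum>j\<in>{1..d}. 1 / p j)))"
      by (intro sum.cong) (simp_all add: A_def distrib_left sum_distrib_left mult_ac)
    also have "\<dots> = (\<Sum>j\<in>{1..d}. 1 / p j *
          (\<Sum>e\<in>multi_indices d m. F e * ?P x e * (y j (e j) powr p j / x j (e j) powr p j)))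
        + multilinear_form d m F x * (1 - (\<Sum>j\<in>{1..d}. 1 / p j))"
      unfolding sum.distrib multilinear_form_def sum_distrib_right
      by (subst sum.swap) (simp only: sum_distrib_left)
    also have "\<dots> = (\<Sum>j\<in>{1..d}. 1 / p j * multilinear_form d m F x)
        + multilinear_form d m F x * (1 - (\<Sum>j\<in>{1..d}. 1 / p j))"
    proof -
      have "(\<Sum>e\<in>multi_indices d m. F e * ?P x e * (y j (e j) powr p j / x j (e j) powr p j))
          = multilinear_form d m F x" if j: "j \<in> {1..d}" for j
        using solution_sum_entries[OF x j, of "\<lambda>i. y j i powr p j"] y j
        by (simp add: is_solution_iff unit_tuples_iff)
      then show ?thesis by simp
    qed
    also have "\<dots> = multilinear_form d m F x"
      unfolding sum_distrib_right[symmetric] by (simp add: algebra_simps)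
    finally show ?thesis .
  qed
  have term_le: "F e * ?P y e \<le> F e * (?P x e * A x y e)"
    if "positive_tuple d m x" "positive_tuple d m y" "e \<in> multi_indices d m" for x y e
    unfolding A_def using am_gm_entry(1)[OF that] F_ge_0[OF that(3)] by (rule mult_left_mono)
  have "multilinear_form d m F y \<le> multilinear_form d m F x"
    if "is_solution d m p F x" "positive_tuple d m x" "is_solution d m p F y" "positive_tuple d m y" for x y
    unfolding sum_A[OF that(1-3), symmetric] unfolding multilinear_form_def
    by (intro sum_mono term_le that)
  \<comment> \<open>Exchanging the two solutions gives equal values, so AM-GM summed over all
    entries is an equality, and hence the weighted terms agree entry by entry.\<close>
  from this[OF x y] this[OF y x]
  have sums_eq: "(\<Sum>e\<in>multi_indices d m. F e * ?P y e) = (\<Sum>e\<in>multi_indices d m. F e * (?P x e * A x y e))"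
    unfolding sum_A[OF x y(1)] by (simp add: multilinear_form_def)
  have terms_eq: "F e * ?P y e = F e * (?P x e * A x y e)" if e: "e \<in> multi_indices d m" for e
  proof (rule ccontr)
    assume "F e * ?P y e \<noteq> F e * (?P x e * A x y e)"
    then have "F e * ?P y e < F e * (?P x e * A x y e)"
      using term_le[OF x(2) y(2) e] by (rule order_neq_le_trans)
    then have "(\<Sum>e\<in>multi_indices d m. F e * ?P y e) < (\<Sum>e\<in>multi_indices d m. F e * (?P x e * A x y e))"
      using term_le[OF x(2) y(2)] e by (intro sum_strict_mono_ex1) auto
    then show False using sums_eq by simp
  qed
  define r where "r = (\<lambda>j i. y j i powr p j / x j i powr p j)"
  have r_e: "r j (e j) = A x y e" if "e \<in> multi_indices d m" "F e > 0" "j \<in> {1..d}" for e j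
    using am_gm_entry(2)[OF x(2) y(2) that(1) _ that(3)] terms_eq[OF that(1)] that(2)
    by (simp add: r_def A_def)
  \<comment> \<open>The ratio at a reference vertex. Ratios agree along each positive entry, so
    linkedness spreads this value to all vertices, and the normalisation makes it 1.\<close>
  define c where "c = r 1 1"
  define B where "B = {(j, i) \<in> tensor_vertices d m. r j i = c}"
  have "B \<subseteq> tensor_vertices d m" by (auto simp: B_def)
  moreover have "(1, 1) \<in> B"
    using d_pos m_pos[of 1] by (auto simp: B_def c_def tensor_vertices_def)
  moreover have "link_closed d m F B"
    using r_e multi_indices_nth by (auto simp: link_closed_def B_def tensor_vertices_def)
  ultimately have "B = tensor_vertices d m" using linked by (auto simp: linked_def)
  then have r_c: "r j i = c" if "j \<in> {1..d}" "i \<in> {1..m j}" for j i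
    using that by (auto simp: B_def tensor_vertices_def)
  have pos: "x j i > 0" "y j i > 0" if "j \<in> {1..d}" "i \<in> {1..m j}" for j i
    using x(2) y(2) that by (auto simp: positive_tuple_def)
  have y_c: "y j i powr p j = c * x j i powr p j" if "j \<in> {1..d}" "i \<in> {1..m j}" for j i
    using r_c[OF that] pos[OF that] by (simp add: r_def field_simps)
  have sums: "(\<Sum>i\<in>{1..m 1}. x 1 i powr p 1) = 1" "(\<Sum>i\<in>{1..m 1}. y 1 i powr p 1) = 1"
    using x(1) y(1) d_pos by (auto simp: is_solution_iff unit_tuples_iff)
  have "(\<Sum>i\<in>{1..m 1}. y 1 i powr p 1) = c * (\<Sum>i\<in>{1..m 1}. x 1 i powr p 1)"
    using d_pos by (simp add: y_c sum_distrib_left)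
  then have c1: "c = 1" by (simp add: sums)
  show ?thesis
  proof (rule tuple_eqI)
    show "x \<in> vector_tuples d m" "y \<in> vector_tuples d m"
      using x(1) y(1) by (auto simp: is_solution_def)
    fix j i assume ji: "j \<in> {1..d}" "i \<in> {1..m j}"
    have "y j i powr p j = x j i powr p j" using y_c[OF ji] c1 by simp
    then have "(y j i powr p j) powr (1 / p j) = (x j i powr p j) powr (1 / p j)" by simp
    then show "x j i = y j i" using pos[OF ji] p_pos[OF ji(1)] by (simp add: powr_powr)
  qed
qed

text \<open>For a positive entry with exactly one index \<open>(k, e k)\<close> in the zero set, the
  left-hand side of (S) there is positive, while the right-hand side is a multiple of a positive
  power of 0. Weak irreducibility alone would allow an entry with several vanishing factors.\<close>

lemma irreducible_solution_pos:
  assumes irr: "irreducible_tensor d m F" and x: "is_solution d m p F x"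
  shows "positive_tuple d m x"
proof (rule ccontr)
  assume notpos: "\<not> positive_tuple d m x"
  define Z where "Z = {(j, i) \<in> tensor_vertices d m. x j i = 0}"
  have nn: "nonneg_tuple d m x" using x by (simp add: is_solution_def)
  have "Z \<noteq> {} \<and> Z \<subset> tensor_vertices d m"
    using unit_tuple_zero_set[OF _ notpos] x unfolding is_solution_iff Z_def by blast
  then obtain k e where k: "k \<in> {1..d}" and e: "e \<in> multi_indices d m" "F e > 0" "(k, e k) \<in> Z"
    "\<forall>j\<in>{1..d} - {k}. (j, e j) \<in> tensor_vertices d m - Z"
    using irr unfolding irreducible_tensor_def by metis
  have "x j (e j) > 0" if "j \<in> {1..d} - {k}" for j
    using e(4) that nn unfolding Z_def tensor_vertices_def nonneg_tuple_def by (force simp: less_le)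
  then have "partial_form d m F x k (e k) > 0"
    using F_nonneg nn k e(1,2) by (intro partial_form_pos)
  moreover have "x k (e k) = 0" using e(3) by (simp add: Z_def)
  ultimately show False
    using x k multi_indices_nth[OF e(1) k] by (force simp: is_solution_def)
qed

end

theorem theorem1p1:
  fixes d :: nat and m :: "nat \<Rightarrow> nat" and p :: "nat \<Rightarrow> real"
    and F :: "(nat \<Rightarrow> nat) \<Rightarrow> real"
  assumes "d \<ge> 2"
    and "\<And>j. j \<in> {1..d} \<Longrightarrow> m j \<ge> 2"
    and "nonneg_tensor d m F"
    and "\<And>j. j \<in> {1..d} \<Longrightarrow> p j > 1"
    and "\<And>j. j \<in> {1..d} \<Longrightarrow> p j \<ge> real d"
  shows "(weakly_irreducible d m F \<longrightarrow>
            (\<exists>!x. is_solution d m p F x \<and> positive_tuple d m x)) \<and>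
         (irreducible_tensor d m F \<longrightarrow>
            (\<exists>!x. is_solution d m p F x) \<and>
            (\<forall>x. is_solution d m p F x \<longrightarrow> positive_tuple d m x))"
proof -
  interpret nonneg_multilinear d m p F
  proof
    show "m j \<ge> 1" if "j \<in> {1..d}" for j using assms(2)[OF that] by simp
  qed (use assms in auto)
  have ex1: "\<exists>!x. is_solution d m p F x \<and> positive_tuple d m x" if "linked d m F"
    using positive_solution_exists[OF that] positive_solution_unique[OF that] by metis
  have "\<exists>!x. is_solution d m p F x" if "irreducible_tensor d m F"
    using ex1[OF irreducible_imp_linked[OF assms(1) that]] irreducible_solution_pos[OF that] by metis
  then show ?thesis
    using ex1[OF weakly_irreducible_imp_linked] irreducible_solution_pos by simp
qed

end
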